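(* Let $N\ge 1$. The coefficient matrices $A(U)$ and $B(U)$ of the two-dimensional shallow water moment equations (SWME) $\partial_t U+A(U)\partial_xU+B(U)\partial_yU=S(U)$ (defined in the context) satisfy the rotational invariance $$\cos\theta\,A(U)+\sin\theta\,B(U)=T(\theta)^{-1}A(T(\theta)U)\,T(\theta)$$ for every angle $0\le\theta<2\pi$ and every state $U$.
   Context: State vector: $U=(h,hu_m,hv_m,h\alpha_1,h\beta_1,\dots,h\alpha_N,h\beta_N)^T\in\mathbb{R}^{2N+3}$ with $h>0$; $g>0$ is a constant. $h,u_m,v_m,\alpha_i,\beta_i$ are regarded as functions of $U$. Let $\phi_j$ be the Legendre polynomial of degree $j$ shifted to $[0,1]$ (orthogonal on $[0,1]$) and normalized by $\phi_j(0)=1$. For $1\le i,j,k\le N$ put $A_{ijk}=(2i+1)\int_0^1\phi_i\phi_j\phi_k\,d\zeta$ and $B_{ijk}=(2i+1)\int_0^1\phi_i'(\zeta)\left(\int_0^\zeta\phi_j\,d\hat\zeta\right)\phi_k(\zeta)\,d\zeta$. The matrices are $A(U)=\partial_UF(U)+P(U)$ and $B(U)=\partial_UG(U)+Q(U)$, where $\partial_U$ denotes the Jacobian. Fluxes: the components of $F(U)$, in the same order as those of $U$, are $hu_m$; $h(u_m^2+\sum_{j=1}^N\frac{\alpha_j^2}{2j+1})+\frac12gh^2$; $h(u_mv_m+\sum_{j=1}^N\frac{\alpha_j\beta_j}{2j+1})$; and, for $i=1,\dots,N$, the pair $h(2u_m\alpha_i+\sum_{j,k=1}^NA_{ijk}\alpha_j\alpha_k)$,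 $h(u_m\beta_i+v_m\alpha_i+\sum_{j,k=1}^NA_{ijk}\alpha_j\beta_k)$. The components of $G(U)$ are $hv_m$; $h(u_mv_m+\sum_j\frac{\alpha_j\beta_j}{2j+1})$; $h(v_m^2+\sum_j\frac{\beta_j^2}{2j+1})+\frac12gh^2$; and, for $i=1,\dots,N$, the pair $h(u_m\beta_i+v_m\alpha_i+\sum_{j,k}A_{ijk}\alpha_j\beta_k)$, $h(2v_m\beta_i+\sum_{j,k}A_{ijk}\beta_j\beta_k)$. Non-conservative parts: the first three rows and first three columns of $P(U)$ and $Q(U)$ vanish; the remaining $2N\times 2N$ parts consist of $2\times2$ blocks indexed by $1\le i,j\le N$ (block $i$ corresponding to $(h\alpha_i,h\beta_i)$), which are, with $\delta_{ij}$ the Kronecker delta, $$P_{ij}=\begin{pmatrix}-\delta_{ij}u_m+\sum_kB_{ijk}\alpha_k&0\\-\delta_{ij}v_m+\sum_kB_{ijk}\beta_k&0\end{pmatrix},\qquad Q_{ij}=\begin{pmatrix}0&-\delta_{ij}u_m+\sum_kB_{ijk}\alpha_k\\0&-\delta_{ij}v_m+\sum_kB_{ijk}\beta_k\end{pmatrix}.$$ Rotation matrix: $T(\theta)=\mathrm{diag}(1,T_2(\theta),\dots,T_2(\theta))\in\mathbb{R}^{(2N+3)\times(2N+3)}$ with $T_2(\theta)=\begin{pmatrix}\cos\theta&\sin\theta\\-\sin\theta&\cos\theta\end{pmatrix}$. *)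

theory Defs
  imports "HOL-Analysis.Analysis" "Jordan_Normal_Form.Gauss_Jordan_Elimination"
begin

unbundle no vec_syntax

section \<open>Shifted Legendre polynomials\<close>

text \<open>Rodrigues' formula on the unit interval. The lemmas below show that it yields the
  polynomial of degree \<open>j\<close> that is orthogonal on \<open>[0,1]\<close> to all polynomials of lower degree
  and has value 1 at 0; these properties determine it.\<close>

definition legendre01 :: "nat \<Rightarrow> real poly" where
  "legendre01 j = Polynomial.smult (1 / fact j) ((pderiv ^^ j) ([:0, 1, -1:] ^ j))"

lemma degree_legendre01: "degree (legendre01 j) = j"
  by (simp add: legendre01_def degree_higher_pderiv degree_power_eq)

lemma poly_legendre01_0: "poly (legendre01 j) 0 = 1"
proof -
  have "[:0, 1, -1:] = Polynomial.monom 1 1 * [:1, -1 :: real:]"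
    by (simp add: monom_altdef)
  then have "coeff ([:0, 1, -1 :: real:] ^ j) j = coeff ([:1, -1 :: real:] ^ j) 0"
    by (simp only: power_mult_distrib monom_power) (simp add: coeff_monom_mult)
  also have "\<dots> = 1"
    by (simp add: coeff_0_power)
  finally show ?thesis
    by (simp add: legendre01_def poly_0_coeff_0 coeff_higher_pderiv pochhammer_fact[symmetric])
qed

lemma power_dvd_pderiv:
  fixes p q :: "real poly"
  assumes "q ^ Suc m dvd p"
  shows "q ^ m dvd pderiv p"
proof -
  obtain r where "p = q ^ Suc m * r" using assms by blast
  then have "pderiv p = q ^ m * (q * pderiv r + Polynomial.smult (of_nat (Suc m)) (pderiv q * r))"
    by (simp only: pderiv_mult pderiv_power_Suc) (simp add: algebra_simps smult_add_right)
  then show ?thesis by simp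
qed

lemma power_dvd_higher_pderiv:
  fixes q :: "real poly"
  shows "q ^ m dvd (pderiv ^^ k) (q ^ (m + k))"
proof (induction k arbitrary: m)
  case (Suc k)
  from Suc.IH[of "Suc m"] show ?case by (auto intro: power_dvd_pderiv)
qed simp

lemma legendre01_orthogonal_aux:
  fixes q :: "real poly"
  assumes "degree q < k" "k \<le> n"
  shows "((\<lambda>x. poly q x * poly ((pderiv ^^ k) ([:0, 1, -1:] ^ n)) x) has_integral 0) {0..1}"
  using assms
proof (induction k arbitrary: q)
  case (Suc k)
  let ?D = "(pderiv ^^ k) ([:0, 1, -1 :: real:] ^ n)"
  have "[:0, 1, -1:] ^ (n - k) dvd ?D"
    using power_dvd_higher_pderiv[of "[:0, 1, -1:]" "n - k" k] Suc.prems by simp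
  then have "poly ?D 0 = 0" "poly ?D 1 = 0"
    using Suc.prems by (auto simp: poly_power elim!: dvdE)
  have "((\<lambda>x. poly (pderiv q) x * poly ?D x) has_integral 0) {0..1}"
  proof (cases "degree q = 0")
    case True
    then have "pderiv q = 0" by (simp add: pderiv_eq_0_iff)
    then show ?thesis by simp
  next
    case False
    then show ?thesis using Suc by (simp add: degree_pderiv)
  qed
  moreover have "((\<lambda>x. poly (pderiv q) x * poly ?D x + poly q x * poly (pderiv ?D) x)
      has_integral (poly (q * ?D) 1 - poly (q * ?D) 0)) {0..1}"
  proof (rule fundamental_theorem_of_calculus)
    fix x :: real
    have "(poly (q * ?D) has_real_derivative poly (pderiv (q * ?D)) x) (at x within {0..1})"
      by (rule has_field_derivative_at_within[OF poly_DERIV])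
    then show "(poly (q * ?D) has_vector_derivative
        poly (pderiv q) x * poly ?D x + poly q x * poly (pderiv ?D) x) (at x within {0..1})"
      by (simp add: has_real_derivative_iff_has_vector_derivative pderiv_mult algebra_simps)
  qed simp
  ultimately have "((\<lambda>x. poly (pderiv q) x * poly ?D x + poly q x * poly (pderiv ?D) x -
      poly (pderiv q) x * poly ?D x) has_integral (poly (q * ?D) 1 - poly (q * ?D) 0) - 0) {0..1}"
    by (intro has_integral_diff)
  with \<open>poly ?D 0 = 0\<close> \<open>poly ?D 1 = 0\<close> show ?case by simp
qed simp

lemma legendre01_orthogonal:
  assumes "degree q < j"
  shows "integral {0..1} (\<lambda>x. poly (legendre01 j) x * poly q x) = 0"
proof (rule integral_unique)
  show "((\<lambda>x. poly (legendre01 j) x * poly q x) has_integral 0) {0..1}"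
    using has_integral_mult_right[OF legendre01_orthogonal_aux[OF assms order.refl], of "1 / fact j"]
    by (simp add: legendre01_def mult_ac)
qed

section \<open>Moment coefficients\<close>

definition coeffA :: "nat \<Rightarrow> nat \<Rightarrow> nat \<Rightarrow> real" where
  "coeffA i j k = real (2 * i + 1) *
     integral {0..1} (\<lambda>z. poly (legendre01 i) z * poly (legendre01 j) z * poly (legendre01 k) z)"

definition coeffB :: "nat \<Rightarrow> nat \<Rightarrow> nat \<Rightarrow> real" where
  "coeffB i j k = real (2 * i + 1) *
     integral {0..1} (\<lambda>z. poly (pderiv (legendre01 i)) z *
       integral {0..z} (poly (legendre01 j)) * poly (legendre01 k) z)"

section \<open>State variables\<close>

text \<open>A state has the entries \<open>(h, h u\<^sub>m, h v\<^sub>m, h \<alpha>\<^sub>1, h \<beta>\<^sub>1, \<dots>, h \<alpha>\<^sub>N, h \<beta>\<^sub>N)\<close>; since vectors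
  are indexed from 0 while \<open>\<alpha>\<close> and \<open>\<beta>\<close> are numbered from 1, \<open>h \<alpha>\<^sub>i\<close> has index \<open>2 i + 1\<close> and
  \<open>h \<beta>\<^sub>i\<close> has index \<open>2 i + 2\<close>.\<close>

definition height :: "real vec \<Rightarrow> real" where
  "height U = U $ 0"

definition um :: "real vec \<Rightarrow> real" where
  "um U = U $ 1 / height U"

definition vm :: "real vec \<Rightarrow> real" where
  "vm U = U $ 2 / height U"

definition alpha :: "real vec \<Rightarrow> nat \<Rightarrow> real" where
  "alpha U i = U $ (2 * i + 1) / height U"

definition beta :: "real vec \<Rightarrow> nat \<Rightarrow> real" where
  "beta U i = U $ (2 * i + 2) / height U"

section \<open>Fluxes\<close>

definition flux_F :: "nat \<Rightarrow> real \<Rightarrow> real vec \<Rightarrow> real vec" where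
  "flux_F N g U = (let h = height U; u = um U; v = vm U; a = alpha U; b = beta U in
     vec_of_list
      ([h * u,
        h * (u\<^sup>2 + (\<Sum>j=1..N. (a j)\<^sup>2 / real (2 * j + 1))) + 1 / 2 * g * h\<^sup>2,
        h * (u * v + (\<Sum>j=1..N. a j * b j / real (2 * j + 1)))] @
       concat (map (\<lambda>i.
         [h * (2 * u * a i + (\<Sum>j=1..N. \<Sum>k=1..N. coeffA i j k * a j * a k)),
          h * (u * b i + v * a i + (\<Sum>j=1..N. \<Sum>k=1..N. coeffA i j k * a j * b k))])
         [1..<N + 1])))"

definition flux_G :: "nat \<Rightarrow> real \<Rightarrow> real vec \<Rightarrow> real vec" where
  "flux_G N g U = (let h = height U; u = um U; v = vm U; a = alpha U; b = beta U in
     vec_of_list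
      ([h * v,
        h * (u * v + (\<Sum>j=1..N. a j * b j / real (2 * j + 1))),
        h * (v\<^sup>2 + (\<Sum>j=1..N. (b j)\<^sup>2 / real (2 * j + 1))) + 1 / 2 * g * h\<^sup>2] @
       concat (map (\<lambda>i.
         [h * (u * b i + v * a i + (\<Sum>j=1..N. \<Sum>k=1..N. coeffA i j k * a j * b k)),
          h * (2 * v * b i + (\<Sum>j=1..N. \<Sum>k=1..N. coeffA i j k * b j * b k))])
         [1..<N + 1])))"

text \<open>Entry \<open>(r, c)\<close> is the partial derivative of the \<open>r\<close>-th component with respect to the
  \<open>c\<close>-th coordinate.\<close>

definition jacobian_mat :: "(real vec \<Rightarrow> real vec) \<Rightarrow> real vec \<Rightarrow> real mat" where
  "jacobian_mat f U = mat (dim_vec (f U)) (dim_vec U)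
     (\<lambda>(r, c). deriv (\<lambda>t. f (U + t \<cdot>\<^sub>v unit_vec (dim_vec U) c) $ r) 0)"

section \<open>Non-conservative parts and coefficient matrices\<close>

definition block_P :: "nat \<Rightarrow> real vec \<Rightarrow> nat \<Rightarrow> nat \<Rightarrow> real mat" where
  "block_P N U i j = mat_of_rows_list 2
     [[- (if i = j then um U else 0) + (\<Sum>k=1..N. coeffB i j k * alpha U k), 0],
      [- (if i = j then vm U else 0) + (\<Sum>k=1..N. coeffB i j k * beta U k), 0]]"

definition block_Q :: "nat \<Rightarrow> real vec \<Rightarrow> nat \<Rightarrow> nat \<Rightarrow> real mat" where
  "block_Q N U i j = mat_of_rows_list 2
     [[0, - (if i = j then um U else 0) + (\<Sum>k=1..N. coeffB i j k * alpha U k)],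
      [0, - (if i = j then vm U else 0) + (\<Sum>k=1..N. coeffB i j k * beta U k)]]"

text \<open>The blocks are numbered from 1, the rows and columns of a matrix from 0.\<close>

definition blocks2 :: "nat \<Rightarrow> (nat \<Rightarrow> nat \<Rightarrow> real mat) \<Rightarrow> real mat" where
  "blocks2 N M = mat (2 * N) (2 * N)
     (\<lambda>(r, c). M (r div 2 + 1) (c div 2 + 1) $$ (r mod 2, c mod 2))"

definition noncons_P :: "nat \<Rightarrow> real vec \<Rightarrow> real mat" where
  "noncons_P N U = four_block_mat (0\<^sub>m 3 3) (0\<^sub>m 3 (2 * N))
     (0\<^sub>m (2 * N) 3) (blocks2 N (block_P N U))"

definition noncons_Q :: "nat \<Rightarrow> real vec \<Rightarrow> real mat" where
  "noncons_Q N U = four_block_mat (0\<^sub>m 3 3) (0\<^sub>m 3 (2 * N))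
     (0\<^sub>m (2 * N) 3) (blocks2 N (block_Q N U))"

definition swme_A :: "nat \<Rightarrow> real \<Rightarrow> real vec \<Rightarrow> real mat" where
  "swme_A N g U = jacobian_mat (flux_F N g) U + noncons_P N U"

definition swme_B :: "nat \<Rightarrow> real \<Rightarrow> real vec \<Rightarrow> real mat" where
  "swme_B N g U = jacobian_mat (flux_G N g) U + noncons_Q N U"

section \<open>Rotation\<close>

definition rot2 :: "real \<Rightarrow> real mat" where
  "rot2 \<theta> = mat_of_rows_list 2 [[cos \<theta>, sin \<theta>], [- sin \<theta>, cos \<theta>]]"

text \<open>There are \<open>N + 1\<close> blocks: one for \<open>(h u\<^sub>m, h v\<^sub>m)\<close> and one for each \<open>(h \<alpha>\<^sub>i, h \<beta>\<^sub>i)\<close>.\<close>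

definition rot :: "nat \<Rightarrow> real \<Rightarrow> real mat" where
  "rot N \<theta> = diag_block_mat (1\<^sub>m 1 # replicate (N + 1) (rot2 \<theta>))"

end

theory Submission
  imports Defs
begin

text \<open>The fluxes rotate as a vector, \<open>T (cos \<theta> F(V) + sin \<theta> G(V)) = F(T V)\<close> for every \<open>V\<close>; this is a
  componentwise identity between quadratic forms in \<open>u\<^sub>m, v\<^sub>m, \<alpha>, \<beta>\<close> which uses that \<open>A\<^sub>i\<^sub>j\<^sub>k\<close> is symmetric in
  \<open>j, k\<close>. Differentiating it at \<open>U\<close> in the direction \<open>w\<close> yields
  \<open>T (cos \<theta> F'(U) w + sin \<theta> G'(U) w) = F'(T U) (T w)\<close>. The blocks of \<open>P\<close> and \<open>Q\<close> are the rank one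
  matrices \<open>x (1, 0)\<close> and \<open>x (0, 1)\<close> with the same column \<open>x\<close>, which rotates like \<open>(u\<^sub>m, v\<^sub>m)\<close>, and
  \<open>cos \<theta> (1, 0) + sin \<theta> (0, 1)\<close> is the first row of \<open>T\<^sub>2\<close>; so they satisfy the same relation.\<close>

section \<open>Directional derivatives\<close>

text \<open>The type of vectors of variable dimension is not a normed space, so the library derivative is not
  available. Since the directional derivative is required to be linear in the direction, this notion
  still supports the chain rule for linear substitutions.\<close>

definition directionally_differentiable :: "nat \<Rightarrow> (real vec \<Rightarrow> real) \<Rightarrow> real vec \<Rightarrow> bool" where
  "directionally_differentiable n f U \<longleftrightarrow> (\<exists>d. \<forall>w \<in> carrier_vec n.
     ((\<lambda>t. f (U + t \<cdot>\<^sub>v w)) has_real_derivative (\<Sum>c<n. d c * w $ c)) (at 0))"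

lemma directionally_differentiableI:
  assumes "\<And>w. w \<in> carrier_vec n \<Longrightarrow>
    ((\<lambda>t. f (U + t \<cdot>\<^sub>v w)) has_real_derivative (\<Sum>c<n. d c * w $ c)) (at 0)"
  shows "directionally_differentiable n f U"
  using assms unfolding directionally_differentiable_def by blast

lemma directionally_differentiable_const: "directionally_differentiable n (\<lambda>V. k) U"
  by (rule directionally_differentiableI[where d = "\<lambda>_. 0"]) simp

lemma directionally_differentiable_index:
  assumes "U \<in> carrier_vec n" "i < n"
  shows "directionally_differentiable n (\<lambda>V. V $ i) U"
proof (rule directionally_differentiableI[where d = "\<lambda>c. if c = i then 1 else 0"])
  fix w :: "real vec" assume w: "w \<in> carrier_vec n"
  have "(\<lambda>t. (U + t \<cdot>\<^sub>v w) $ i) = (\<lambda>t. U $ i + t * w $ i)"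
    using assms w by auto
  moreover have "(\<Sum>c<n. (if c = i then 1 else 0) * w $ c) = w $ i"
    using assms by (simp add: if_distrib[of "\<lambda>x. x * _"] cong: if_cong)
  ultimately show "((\<lambda>t. (U + t \<cdot>\<^sub>v w) $ i) has_real_derivative
      (\<Sum>c<n. (if c = i then 1 else 0) * w $ c)) (at 0)"
    by (auto intro!: derivative_eq_intros)
qed

lemma directionally_differentiable_add:
  assumes "directionally_differentiable n f U" "directionally_differentiable n g U"
  shows "directionally_differentiable n (\<lambda>V. f V + g V) U"
proof -
  obtain d e where
    d: "\<And>w. w \<in> carrier_vec n \<Longrightarrow>
      ((\<lambda>t. f (U + t \<cdot>\<^sub>v w)) has_real_derivative (\<Sum>c<n. d c * w $ c)) (at 0)" and
    e: "\<And>w. w \<in> carrier_vec n \<Longrightarrow>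
      ((\<lambda>t. g (U + t \<cdot>\<^sub>v w)) has_real_derivative (\<Sum>c<n. e c * w $ c)) (at 0)"
    using assms unfolding directionally_differentiable_def by blast
  show ?thesis
    by (rule directionally_differentiableI[where d = "\<lambda>c. d c + e c"])
      (use DERIV_add[OF d e] in \<open>simp add: sum.distrib algebra_simps\<close>)
qed

lemma directionally_differentiable_mult:
  assumes "U \<in> carrier_vec n"
    and "directionally_differentiable n f U" "directionally_differentiable n g U"
  shows "directionally_differentiable n (\<lambda>V. f V * g V) U"
proof -
  obtain d e where
    d: "\<And>w. w \<in> carrier_vec n \<Longrightarrow>
      ((\<lambda>t. f (U + t \<cdot>\<^sub>v w)) has_real_derivative (\<Sum>c<n. d c * w $ c)) (at 0)" and
    e: "\<And>w. w \<in> carrier_vec n \<Longrightarrow>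
      ((\<lambda>t. g (U + t \<cdot>\<^sub>v w)) has_real_derivative (\<Sum>c<n. e c * w $ c)) (at 0)"
    using assms unfolding directionally_differentiable_def by blast
  show ?thesis
  proof (rule directionally_differentiableI[where d = "\<lambda>c. d c * g U + e c * f U"])
    fix w :: "real vec" assume w: "w \<in> carrier_vec n"
    \<comment> \<open>The product rule yields the values of \<open>f\<close> and \<open>g\<close> at
      \<open>U + 0 \<cdot>\<^sub>v w\<close>. Rewriting them to values at \<open>U\<close> makes the
      coefficients of the linear form independent of \<open>w\<close>.\<close>
    have "U + 0 \<cdot>\<^sub>v w = U" using assms(1) w by auto
    then show "((\<lambda>t. f (U + t \<cdot>\<^sub>v w) * g (U + t \<cdot>\<^sub>v w)) has_real_derivative
        (\<Sum>c<n. (d c * g U + e c * f U) * w $ c)) (at 0)"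
      using DERIV_mult[OF d[OF w] e[OF w]]
      by (simp add: sum.distrib algebra_simps sum_distrib_left)
  qed
qed

lemma directionally_differentiable_inverse:
  assumes "U \<in> carrier_vec n" "f U \<noteq> 0" "directionally_differentiable n f U"
  shows "directionally_differentiable n (\<lambda>V. inverse (f V)) U"
proof -
  obtain d where
    d: "\<And>w. w \<in> carrier_vec n \<Longrightarrow>
      ((\<lambda>t. f (U + t \<cdot>\<^sub>v w)) has_real_derivative (\<Sum>c<n. d c * w $ c)) (at 0)"
    using assms unfolding directionally_differentiable_def by blast
  show ?thesis
  proof (rule directionally_differentiableI[where d = "\<lambda>c. - (inverse (f U) * d c * inverse (f U))"])
    fix w :: "real vec" assume w: "w \<in> carrier_vec n"
    have "U + 0 \<cdot>\<^sub>v w = U" using assms(1) w by auto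
    then show "((\<lambda>t. inverse (f (U + t \<cdot>\<^sub>v w))) has_real_derivative
        (\<Sum>c<n. - (inverse (f U) * d c * inverse (f U)) * w $ c)) (at 0)"
      using DERIV_inverse'[OF d[OF w]] assms(2)
      by (simp add: sum_negf sum_distrib_left sum_distrib_right mult_ac)
  qed
qed

lemma directionally_differentiable_divide:
  assumes "U \<in> carrier_vec n" "g U \<noteq> 0"
    and "directionally_differentiable n f U" "directionally_differentiable n g U"
  shows "directionally_differentiable n (\<lambda>V. f V / g V) U"
  unfolding divide_inverse
  by (intro directionally_differentiable_mult directionally_differentiable_inverse assms)

lemma directionally_differentiable_sum:
  assumes "\<And>i. i \<in> I \<Longrightarrow> directionally_differentiable n (\<lambda>V. f V i) U"
  shows "directionally_differentiable n (\<lambda>V. \<Sum>i\<in>I. f V i) U"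
  using assms
  by (induction I rule: infinite_finite_induct)
    (auto intro!: directionally_differentiable_const directionally_differentiable_add)

lemma directionally_differentiable_power:
  assumes "U \<in> carrier_vec n" "directionally_differentiable n f U"
  shows "directionally_differentiable n (\<lambda>V. f V ^ k) U"
  by (induction k)
    (auto intro!: directionally_differentiable_const directionally_differentiable_mult assms)

section \<open>The Jacobian matrix as a directional derivative\<close>

lemma jacobian_mat_carrier:
  "jacobian_mat f U \<in> carrier_mat (dim_vec (f U)) (dim_vec U)"
  by (simp add: jacobian_mat_def)

text \<open>The entries of \<open>jacobian_mat\<close> are derivatives along unit vectors only.
  Linearity of the directional derivative identifies them with its coefficients, which extends the
  formula to every direction \<open>w\<close>.\<close>

lemma jacobian_mult_vec:
  assumes U: "U \<in> carrier_vec n" and w: "w \<in> carrier_vec n" and r: "r < dim_vec (f U)"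
    and diff: "directionally_differentiable n (\<lambda>V. f V $ r) U"
  shows "((\<lambda>t. f (U + t \<cdot>\<^sub>v w) $ r) has_real_derivative (jacobian_mat f U *\<^sub>v w) $ r) (at 0)"
proof -
  obtain d where d: "\<And>w. w \<in> carrier_vec n \<Longrightarrow>
      ((\<lambda>t. f (U + t \<cdot>\<^sub>v w) $ r) has_real_derivative (\<Sum>c<n. d c * w $ c)) (at 0)"
    using diff unfolding directionally_differentiable_def by blast
  have "deriv (\<lambda>t. f (U + t \<cdot>\<^sub>v unit_vec n c) $ r) 0 = d c" if c: "c < n" for c
  proof -
    have "(\<Sum>k<n. d k * unit_vec n c $ k) = (\<Sum>k<n. if k = c then d k else 0)"
      using c by (intro sum.cong) (auto simp: unit_vec_def)
    also have "\<dots> = d c" using c by simp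
    finally show ?thesis
      using DERIV_imp_deriv[OF d[of "unit_vec n c"]] by simp
  qed
  then have "(jacobian_mat f U *\<^sub>v w) $ r = (\<Sum>c<n. d c * w $ c)"
    using U w r
    by (auto simp: jacobian_mat_def scalar_prod_def lessThan_atLeast0 intro!: sum.cong)
  with d[OF w] show ?thesis by simp
qed

section \<open>Interleaved indexing\<close>

text \<open>The pair \<open>i = 0\<close> is \<open>(h u\<^sub>m, h v\<^sub>m)\<close> and the pairs
  \<open>i > 0\<close> hold the moments, so the rotation acts in the same way on all
  \<open>N + 1\<close> pairs.\<close>

lemma interleaved_index_cases:
  fixes r N :: nat
  assumes "r < 2 * N + 3"
  obtains "r = 0" | i where "i \<le> N" "r = 2 * i + 1" | i where "i \<le> N" "r = 2 * i + 2"
proof (cases r)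
  case (Suc m)
  then show ?thesis
    using assms that(2)[of "m div 2"] that(3)[of "m div 2"]
    by (cases "even m") (auto elim!: evenE oddE)
qed (use that(1) in simp)

lemma sum_interleave:
  fixes f :: "nat \<Rightarrow> 'a::comm_monoid_add"
  shows "(\<Sum>k<2 * N + 3. f k) = f 0 + (\<Sum>i\<le>N. f (2 * i + 1) + f (2 * i + 2))"
proof (induction N)
  case 0
  show ?case by (simp add: numeral_3_eq_3 add_ac)
next
  case (Suc N)
  \<comment> \<open>Passing from \<open>N\<close> to \<open>Suc N\<close> adds the indices
    \<open>2 * N + 3\<close> and \<open>2 * N + 4\<close>, the two members of the pair
    \<open>i = Suc N\<close>.\<close>
  have eqs: "2 * Suc N + 3 = Suc (Suc (2 * N + 3))" "2 * N + 3 = 2 * Suc N + 1"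
    "Suc (2 * N + 3) = 2 * Suc N + 2"
    by simp_all
  have "(\<Sum>k<2 * Suc N + 3. f k) = (\<Sum>k<2 * N + 3. f k) + (f (2 * N + 3) + f (Suc (2 * N + 3)))"
    unfolding eqs(1) by (simp only: sum.lessThan_Suc add_ac)
  also have "\<dots> = f 0 + (\<Sum>i\<le>Suc N. f (2 * i + 1) + f (2 * i + 2))"
    unfolding Suc eqs(2,3)[THEN arg_cong[where f = f]] by (simp only: sum.atMost_Suc add_ac)
  finally show ?case .
qed

lemma mult_vec_interleave:
  assumes "M \<in> carrier_mat (2 * N + 3) (2 * N + 3)" "w \<in> carrier_vec (2 * N + 3)" "r < 2 * N + 3"
  shows "(M *\<^sub>v w) $ r = M $$ (r, 0) * w $ 0 +
    (\<Sum>i\<le>N. M $$ (r, 2 * i + 1) * w $ (2 * i + 1) + M $$ (r, 2 * i + 2) * w $ (2 * i + 2))"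
proof -
  have "(M *\<^sub>v w) $ r = (\<Sum>k<2 * N + 3. M $$ (r, k) * w $ k)"
    using assms by (auto simp: scalar_prod_def lessThan_atLeast0 intro!: sum.cong)
  then show ?thesis by (simp only: sum_interleave)
qed

lemma length_concat_pairs: "length (concat (map (\<lambda>i. [f i, g i]) [1..<m + 1])) = 2 * m"
  by (induction m) auto

text \<open>Positions in the list count pairs from 0, whereas \<open>f\<close> and \<open>g\<close>
  are called from 1 on; hence \<open>k + 1\<close>. Induction on \<open>m\<close> appends a pair at
  the end and leaves the earlier positions fixed.\<close>

lemma concat_pairs_nth:
  assumes "k < m"
  shows "concat (map (\<lambda>i. [f i, g i]) [1..<m + 1]) ! (2 * k) = f (k + 1)"
    and "concat (map (\<lambda>i. [f i, g i]) [1..<m + 1]) ! (2 * k + 1) = g (k + 1)"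
proof -
  have "concat (map (\<lambda>i. [f i, g i]) [1..<m + 1]) ! (2 * k) = f (k + 1) \<and>
        concat (map (\<lambda>i. [f i, g i]) [1..<m + 1]) ! (2 * k + 1) = g (k + 1)"
    using assms
  proof (induction m)
    case (Suc m)
    then show ?case using length_concat_pairs[of f g m]
      by (cases "k = m") (auto simp: nth_append)
  qed simp
  then show "concat (map (\<lambda>i. [f i, g i]) [1..<m + 1]) ! (2 * k) = f (k + 1)"
    and "concat (map (\<lambda>i. [f i, g i]) [1..<m + 1]) ! (2 * k + 1) = g (k + 1)"
    by auto
qed

section \<open>The rotation matrix\<close>

lemma rot2_carrier: "rot2 \<theta> \<in> carrier_mat 2 2"
  by (simp add: rot2_def mat_of_rows_list_def numeral_2_eq_2)

lemma rot2_index: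
  "rot2 \<theta> $$ (0, 0) = cos \<theta>" "rot2 \<theta> $$ (0, Suc 0) = sin \<theta>"
  "rot2 \<theta> $$ (Suc 0, 0) = - sin \<theta>" "rot2 \<theta> $$ (Suc 0, Suc 0) = cos \<theta>"
  by (simp_all add: rot2_def mat_of_rows_list_def)

text \<open>A closed form of the block diagonal matrix: \<open>div 2\<close> is the number of the
  block and \<open>mod 2\<close> the position inside it.\<close>

lemma diag_block_replicate:
  assumes "B \<in> carrier_mat 2 2"
  shows "diag_block_mat (replicate m B) = mat (2 * m) (2 * m)
    (\<lambda>(r, c). if r div 2 = c div 2 then B $$ (r mod 2, c mod 2) else 0)"
proof (induction m)
  case 0
  show ?case by auto
next
  case (Suc m)
  show ?case
  proof (rule eq_matI)
    fix r c
    assume "r < dim_row (mat (2 * Suc m) (2 * Suc m)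
        (\<lambda>(r, c). if r div 2 = c div 2 then B $$ (r mod 2, c mod 2) else 0))"
      "c < dim_col (mat (2 * Suc m) (2 * Suc m)
        (\<lambda>(r, c). if r div 2 = c div 2 then B $$ (r mod 2, c mod 2) else 0))"
    then have rc: "r < 2 * Suc m" "c < 2 * Suc m" by auto
    \<comment> \<open>\<open>diag_block_mat\<close> splits off the first block. Indices beyond it
      drop by 2, which lowers the block number by one and keeps the position inside the
      block.\<close>
    have "k div 2 = 0 \<and> k mod 2 = k" if "k < 2" for k :: nat
      using that by auto
    moreover have "k div 2 = Suc ((k - 2) div 2) \<and> (k - 2) mod 2 = k mod 2" if "\<not> k < 2" for k :: nat
      using that le_div_geq[of 2 k] le_mod_geq[of 2 k] by simp
    ultimately show "diag_block_mat (replicate (Suc m) B) $$ (r, c) = mat (2 * Suc m) (2 * Suc m)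
        (\<lambda>(r, c). if r div 2 = c div 2 then B $$ (r mod 2, c mod 2) else 0) $$ (r, c)"
      using rc assms Suc by (cases "r < 2"; cases "c < 2") (simp_all add: Let_def)
  qed (use assms Suc in \<open>auto simp: Let_def\<close>)
qed

lemma rot_conv_four_block:
  "rot N \<theta> = four_block_mat (1\<^sub>m 1) (0\<^sub>m 1 (2 * N + 2)) (0\<^sub>m (2 * N + 2) 1)
    (mat (2 * N + 2) (2 * N + 2)
      (\<lambda>(r, c). if r div 2 = c div 2 then rot2 \<theta> $$ (r mod 2, c mod 2) else 0))"
proof -
  have "2 * (N + 1) = 2 * N + 2" by simp
  then show ?thesis
    by (simp only: rot_def diag_block_mat.simps Let_def diag_block_replicate[OF rot2_carrier]
      dim_row_mat dim_col_mat index_one_mat)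
qed

lemma rot_carrier: "rot N \<theta> \<in> carrier_mat (2 * N + 3) (2 * N + 3)"
  by (rule carrier_matI) (simp_all add: rot_conv_four_block)

text \<open>The leading diagonal entry 1 shifts all \<open>rot2\<close> blocks by one, hence
  \<open>r - 1\<close> and \<open>c - 1\<close>.\<close>

lemma rot_index:
  assumes "r < 2 * N + 3" "c < 2 * N + 3"
  shows "rot N \<theta> $$ (r, c) = (if r = 0 \<or> c = 0 then (if r = c then 1 else 0)
    else if (r - 1) div 2 = (c - 1) div 2 then rot2 \<theta> $$ ((r - 1) mod 2, (c - 1) mod 2) else 0)"
  using assms by (cases r; cases c) (simp_all add: rot_conv_four_block)

lemma rot_block_index:
  assumes "i \<le> N" "j \<le> N"
  shows "rot N \<theta> $$ (2 * i + 1, 2 * j + 1) = (if i = j then cos \<theta> else 0)"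
    and "rot N \<theta> $$ (2 * i + 1, 2 * j + 2) = (if i = j then sin \<theta> else 0)"
    and "rot N \<theta> $$ (2 * i + 2, 2 * j + 1) = (if i = j then - sin \<theta> else 0)"
    and "rot N \<theta> $$ (2 * i + 2, 2 * j + 2) = (if i = j then cos \<theta> else 0)"
  using assms rot2_index[of \<theta>] by (simp_all add: rot_index)

text \<open>In the rows of pair \<open>i\<close> only the diagonal block contributes, which leaves
  \<open>rot2\<close> applied to that pair. The case \<open>i = 0\<close> gives the rule for
  \<open>(h u\<^sub>m, h v\<^sub>m)\<close>.\<close>

lemma rot_mult_vec:
  assumes "V \<in> carrier_vec (2 * N + 3)"
  shows "(rot N \<theta> *\<^sub>v V) $ 0 = V $ 0"
    and "i \<le> N \<Longrightarrow> (rot N \<theta> *\<^sub>v V) $ (2 * i + 1) = cos \<theta> * V $ (2 * i + 1) + sin \<theta> * V $ (2 * i + 2)"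
    and "i \<le> N \<Longrightarrow> (rot N \<theta> *\<^sub>v V) $ (2 * i + 2) = cos \<theta> * V $ (2 * i + 2) - sin \<theta> * V $ (2 * i + 1)"
proof -
  note mv = mult_vec_interleave[OF rot_carrier[of N \<theta>] assms]
  show "(rot N \<theta> *\<^sub>v V) $ 0 = V $ 0"
    by (subst mv) (auto simp: rot_index)
  have zero: "rot N \<theta> $$ (r, 0) = 0" if "0 < r" "r < 2 * N + 3" for r
    using that by (simp add: rot_index)
  show "(rot N \<theta> *\<^sub>v V) $ (2 * i + 1) = cos \<theta> * V $ (2 * i + 1) + sin \<theta> * V $ (2 * i + 2)" if i: "i \<le> N"
  proof -
    have "(rot N \<theta> *\<^sub>v V) $ (2 * i + 1) =
      (\<Sum>j\<le>N. rot N \<theta> $$ (2 * i + 1, 2 * j + 1) * V $ (2 * j + 1)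
        + rot N \<theta> $$ (2 * i + 1, 2 * j + 2) * V $ (2 * j + 2))"
      using i by (subst mv) (simp_all add: zero)
    also have "\<dots> = (\<Sum>j\<le>N. if i = j then cos \<theta> * V $ (2 * j + 1) + sin \<theta> * V $ (2 * j + 2) else 0)"
      by (rule sum.cong[OF refl]) (use i in \<open>simp only: rot_block_index atMost_iff, simp\<close>)
    finally show ?thesis using i by simp
  qed
  show "(rot N \<theta> *\<^sub>v V) $ (2 * i + 2) = cos \<theta> * V $ (2 * i + 2) - sin \<theta> * V $ (2 * i + 1)" if i: "i \<le> N"
  proof -
    have "(rot N \<theta> *\<^sub>v V) $ (2 * i + 2) =
      (\<Sum>j\<le>N. rot N \<theta> $$ (2 * i + 2, 2 * j + 1) * V $ (2 * j + 1)
        + rot N \<theta> $$ (2 * i + 2, 2 * j + 2) * V $ (2 * j + 2))"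
      using i by (subst mv) (simp_all add: zero)
    also have "\<dots> = (\<Sum>j\<le>N. if i = j then cos \<theta> * V $ (2 * j + 2) - sin \<theta> * V $ (2 * j + 1) else 0)"
      by (rule sum.cong[OF refl]) (use i in \<open>simp only: rot_block_index atMost_iff, simp\<close>)
    finally show ?thesis using i by simp
  qed
qed

lemma rot_mult_vec_carrier: "rot N \<theta> *\<^sub>v V \<in> carrier_vec (2 * N + 3)"
  by (rule carrier_vecI) (simp add: carrier_matD[OF rot_carrier])

text \<open>Products with unit vectors are the columns. Matrix identities can thus be checked
  direction by direction, which is the form that directional derivatives provide.\<close>

lemma mat_eq_if_mult_vec_eq:
  fixes A B :: "real mat"
  assumes A: "A \<in> carrier_mat n m" and B: "B \<in> carrier_mat n m"
    and eq: "\<And>w. w \<in> carrier_vec m \<Longrightarrow> A *\<^sub>v w = B *\<^sub>v w"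
  shows "A = B"
proof (rule mat_col_eqI)
  fix i assume "i < dim_col B"
  then have i: "i < m" using B by simp
  have unit: "M *\<^sub>v unit_vec m i = col M i" if "M \<in> carrier_mat n m" for M :: "real mat"
    using that i by (intro eq_vecI) auto
  show "col A i = col B i"
    using eq[of "unit_vec m i"] unit[OF A] unit[OF B] by simp
qed (use A B in auto)

lemma rot_inverse: "rot N (- \<theta>) * rot N \<theta> = 1\<^sub>m (2 * N + 3)"
proof (rule mat_eq_if_mult_vec_eq)
  fix w :: "real vec" assume w: "w \<in> carrier_vec (2 * N + 3)"
  \<comment> \<open>Rotating a pair by \<theta> and then by -\<theta> multiplies both entries by
    \<open>s\<^sup>2 + c\<^sup>2\<close>, which is 1 for \<open>c = cos \<theta>\<close> and
    \<open>s = sin \<theta>\<close>.\<close>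
  have "c * (c * x + s * y) - s * (c * y - s * x) = (s\<^sup>2 + c\<^sup>2) * x"
    "c * (c * y - s * x) + s * (c * x + s * y) = (s\<^sup>2 + c\<^sup>2) * y" for c s x y :: real
    by (simp_all add: power2_eq_square algebra_simps)
  note sq = this[of "cos \<theta>" _ "sin \<theta>", unfolded sin_cos_squared_add mult_1_left]
  have "(rot N (- \<theta>) *\<^sub>v (rot N \<theta> *\<^sub>v w)) $ r = w $ r" if "r < 2 * N + 3" for r
    using that
  proof (cases rule: interleaved_index_cases)
    case 1
    show ?thesis unfolding 1 rot_mult_vec(1)[OF w] rot_mult_vec(1)[OF rot_mult_vec_carrier] ..
  next
    case (2 i)
    show ?thesis
      unfolding 2(2) rot_mult_vec(2)[OF rot_mult_vec_carrier 2(1)] rot_mult_vec(2,3)[OF w 2(1)]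
      using sq(1) by simp
  next
    case (3 i)
    show ?thesis
      unfolding 3(2) rot_mult_vec(3)[OF rot_mult_vec_carrier 3(1)] rot_mult_vec(2,3)[OF w 3(1)]
      using sq(2) by simp
  qed
  then have "rot N (- \<theta>) *\<^sub>v (rot N \<theta> *\<^sub>v w) = w"
    using w rot_carrier[of N "- \<theta>"] by (intro eq_vecI) auto
  then show "rot N (- \<theta>) * rot N \<theta> *\<^sub>v w = 1\<^sub>m (2 * N + 3) *\<^sub>v w"
    using assoc_mult_mat_vec[OF rot_carrier rot_carrier w] w by simp
qed (use mult_carrier_mat[OF rot_carrier rot_carrier] in auto)

text \<open>The height is invariant, so the linear action on each pair survives division by it. This
  includes height zero, where all quotients are 0 by convention.\<close>

lemma state_variables_rot:
  assumes "V \<in> carrier_vec (2 * N + 3)"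
  shows "height (rot N \<theta> *\<^sub>v V) = height V"
    and "um (rot N \<theta> *\<^sub>v V) = cos \<theta> * um V + sin \<theta> * vm V"
    and "vm (rot N \<theta> *\<^sub>v V) = cos \<theta> * vm V - sin \<theta> * um V"
    and "i \<le> N \<Longrightarrow> alpha (rot N \<theta> *\<^sub>v V) i = cos \<theta> * alpha V i + sin \<theta> * beta V i"
    and "i \<le> N \<Longrightarrow> beta (rot N \<theta> *\<^sub>v V) i = cos \<theta> * beta V i - sin \<theta> * alpha V i"
proof -
  note [simp] = height_def um_def vm_def alpha_def beta_def
  note r = rot_mult_vec[OF assms]
  show h: "height (rot N \<theta> *\<^sub>v V) = height V"
    using r(1) by simp
  show "um (rot N \<theta> *\<^sub>v V) = cos \<theta> * um V + sin \<theta> * vm V"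
    "vm (rot N \<theta> *\<^sub>v V) = cos \<theta> * vm V - sin \<theta> * um V"
    using r(1) r(2)[of 0] r(3)[of 0]
    by (simp_all add: add_divide_distrib diff_divide_distrib numeral_2_eq_2)
  show "alpha (rot N \<theta> *\<^sub>v V) i = cos \<theta> * alpha V i + sin \<theta> * beta V i"
    "beta (rot N \<theta> *\<^sub>v V) i = cos \<theta> * beta V i - sin \<theta> * alpha V i" if "i \<le> N"
    using r(1) r(2,3)[OF that]
    by (simp_all add: add_divide_distrib diff_divide_distrib)
qed

section \<open>The fluxes\<close>

lemma flux_dim: "dim_vec (flux_F N g U) = 2 * N + 3" "dim_vec (flux_G N g U) = 2 * N + 3"
  using length_concat_pairs[of _ _ N]
  by (simp_all add: flux_F_def flux_G_def Let_def del: upt_Suc)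

lemma flux_F_index:
  "flux_F N g U $ 0 = height U * um U"
  "flux_F N g U $ 1 = height U * ((um U)\<^sup>2 + (\<Sum>j=1..N. (alpha U j)\<^sup>2 / real (2 * j + 1)))
     + 1 / 2 * g * (height U)\<^sup>2"
  "flux_F N g U $ 2 =
     height U * (um U * vm U + (\<Sum>j=1..N. alpha U j * beta U j / real (2 * j + 1)))"
  "i \<in> {1..N} \<Longrightarrow> flux_F N g U $ (2 * i + 1) = height U *
     (2 * um U * alpha U i + (\<Sum>j=1..N. \<Sum>k=1..N. coeffA i j k * alpha U j * alpha U k))"
  "i \<in> {1..N} \<Longrightarrow> flux_F N g U $ (2 * i + 2) = height U *
     (um U * beta U i + vm U * alpha U i +
       (\<Sum>j=1..N. \<Sum>k=1..N. coeffA i j k * alpha U j * beta U k))"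
proof -
  show "flux_F N g U $ 0 = height U * um U"
    "flux_F N g U $ 1 = height U * ((um U)\<^sup>2 + (\<Sum>j=1..N. (alpha U j)\<^sup>2 / real (2 * j + 1)))
     + 1 / 2 * g * (height U)\<^sup>2"
    "flux_F N g U $ 2 =
     height U * (um U * vm U + (\<Sum>j=1..N. alpha U j * beta U j / real (2 * j + 1)))"
    by (simp_all add: flux_F_def Let_def vec_of_list_index del: upt_Suc vec_of_list_Cons)
next
  assume "i \<in> {1..N}"
  \<comment> \<open>The moments are numbered from 1 and the pairs of the list from 0. With the three
    leading entries, pair \<open>k\<close> starts at position
    \<open>2 * k + 3 = 2 * i + 1\<close>.\<close>
  then obtain k where k: "i = Suc k" "k < N" by (cases i) auto
  show "flux_F N g U $ (2 * i + 1) = height U *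
     (2 * um U * alpha U i + (\<Sum>j=1..N. \<Sum>k=1..N. coeffA i j k * alpha U j * alpha U k))"
    using concat_pairs_nth(1)[OF k(2)] k(1)
    by (simp add: flux_F_def Let_def vec_of_list_index del: upt_Suc vec_of_list_Cons)
  show "flux_F N g U $ (2 * i + 2) = height U *
     (um U * beta U i + vm U * alpha U i +
       (\<Sum>j=1..N. \<Sum>k=1..N. coeffA i j k * alpha U j * beta U k))"
    using concat_pairs_nth(2)[OF k(2)] k(1)
    by (simp add: flux_F_def Let_def vec_of_list_index del: upt_Suc vec_of_list_Cons)
qed

lemma flux_G_index:
  "flux_G N g U $ 0 = height U * vm U"
  "flux_G N g U $ 1 =
     height U * (um U * vm U + (\<Sum>j=1..N. alpha U j * beta U j / real (2 * j + 1)))"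
  "flux_G N g U $ 2 = height U * ((vm U)\<^sup>2 + (\<Sum>j=1..N. (beta U j)\<^sup>2 / real (2 * j + 1)))
     + 1 / 2 * g * (height U)\<^sup>2"
  "i \<in> {1..N} \<Longrightarrow> flux_G N g U $ (2 * i + 1) = height U *
     (um U * beta U i + vm U * alpha U i +
       (\<Sum>j=1..N. \<Sum>k=1..N. coeffA i j k * alpha U j * beta U k))"
  "i \<in> {1..N} \<Longrightarrow> flux_G N g U $ (2 * i + 2) = height U *
     (2 * vm U * beta U i + (\<Sum>j=1..N. \<Sum>k=1..N. coeffA i j k * beta U j * beta U k))"
proof -
  show "flux_G N g U $ 0 = height U * vm U"
    "flux_G N g U $ 1 =
     height U * (um U * vm U + (\<Sum>j=1..N. alpha U j * beta U j / real (2 * j + 1)))"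
    "flux_G N g U $ 2 = height U * ((vm U)\<^sup>2 + (\<Sum>j=1..N. (beta U j)\<^sup>2 / real (2 * j + 1)))
     + 1 / 2 * g * (height U)\<^sup>2"
    by (simp_all add: flux_G_def Let_def vec_of_list_index del: upt_Suc vec_of_list_Cons)
next
  assume "i \<in> {1..N}"
  then obtain k where k: "i = Suc k" "k < N" by (cases i) auto
  show "flux_G N g U $ (2 * i + 1) = height U *
     (um U * beta U i + vm U * alpha U i +
       (\<Sum>j=1..N. \<Sum>k=1..N. coeffA i j k * alpha U j * beta U k))"
    using concat_pairs_nth(1)[OF k(2)] k(1)
    by (simp add: flux_G_def Let_def vec_of_list_index del: upt_Suc vec_of_list_Cons)
  show "flux_G N g U $ (2 * i + 2) = height U *
     (2 * vm U * beta U i + (\<Sum>j=1..N. \<Sum>k=1..N. coeffA i j k * beta U j * beta U k))"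
    using concat_pairs_nth(2)[OF k(2)] k(1)
    by (simp add: flux_G_def Let_def vec_of_list_index del: upt_Suc vec_of_list_Cons)
qed

text \<open>The flux components of pair 0 have formulas of their own, with the gravity term, so this
  pair is separated from the moments.\<close>

lemma flux_index_cases:
  fixes r N :: nat
  assumes "r < 2 * N + 3"
  obtains "r = 0" | "r = 1" | "r = 2"
    | i where "i \<in> {1..N}" "r = 2 * i + 1" | i where "i \<in> {1..N}" "r = 2 * i + 2"
  using assms
proof (cases rule: interleaved_index_cases)
  case (2 i)
  then show ?thesis using that(2,4) by (cases "i = 0") auto
next
  case (3 i)
  then show ?thesis using that(3,5) by (cases "i = 0") auto
qed (use that in auto)

text \<open>Each component is a polynomial in the state variables, and these are coordinates or
  quotients of coordinates by the height, which is nonzero at \<open>U\<close>.\<close>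

lemma flux_differentiable:
  assumes U: "U \<in> carrier_vec (2 * N + 3)" and h: "height U \<noteq> 0" and r: "r < 2 * N + 3"
  shows "directionally_differentiable (2 * N + 3) (\<lambda>V. flux_F N g V $ r) U"
    and "directionally_differentiable (2 * N + 3) (\<lambda>V. flux_G N g V $ r) U"
proof -
  let ?D = "\<lambda>f. directionally_differentiable (2 * N + 3) f U"
  note intros = directionally_differentiable_const directionally_differentiable_add
    directionally_differentiable_mult[OF U] directionally_differentiable_sum
    directionally_differentiable_power[OF U] directionally_differentiable_divide[OF U]
    directionally_differentiable_index[OF U]
  have height: "?D height"
    unfolding height_def[abs_def] by (intro intros) simp
  have um: "?D um" and vm: "?D vm"
    unfolding um_def[abs_def] vm_def[abs_def] using h by (intro intros height; simp)+
  have alpha: "?D (\<lambda>V. alpha V i)" and beta: "?D (\<lambda>V. beta V i)" if "i \<in> {1..N}" for i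
    unfolding alpha_def beta_def using h that by (intro intros height; simp)+
  note intros = intros height um vm alpha beta
  from r show "?D (\<lambda>V. flux_F N g V $ r)"
    by (cases rule: flux_index_cases) (auto simp only: flux_F_index intro!: intros)
  from r show "?D (\<lambda>V. flux_G N g V $ r)"
    by (cases rule: flux_index_cases) (auto simp only: flux_G_index intro!: intros)
qed

section \<open>Rotation of the fluxes\<close>

lemma coeffA_commute: "coeffA i j k = coeffA i k j"
  by (simp add: coeffA_def mult_ac)

text \<open>Expansion yields two mixed sums, over \<open>p j * q k\<close> and over
  \<open>q j * p k\<close>. They agree by symmetry of \<open>K\<close>, which leaves exactly the
  three sums that occur in the fluxes when \<open>K = coeffA i\<close>, \<open>p = alpha V\<close>
  and \<open>q = beta V\<close>.\<close>

lemma symmetric_form_rotate: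
  fixes K :: "nat \<Rightarrow> nat \<Rightarrow> real"
  assumes sym: "\<And>j k. K j k = K k j"
  shows "(\<Sum>j\<in>I. \<Sum>k\<in>I. K j k * (c * p j + s * q j) * (c * p k + s * q k)) =
      c * c * (\<Sum>j\<in>I. \<Sum>k\<in>I. K j k * p j * p k) +
      2 * c * s * (\<Sum>j\<in>I. \<Sum>k\<in>I. K j k * p j * q k) +
      s * s * (\<Sum>j\<in>I. \<Sum>k\<in>I. K j k * q j * q k)" (is ?diagonal)
    and "(\<Sum>j\<in>I. \<Sum>k\<in>I. K j k * (c * p j + s * q j) * (c * q k - s * p k)) =
      c * c * (\<Sum>j\<in>I. \<Sum>k\<in>I. K j k * p j * q k) +
      c * s * (\<Sum>j\<in>I. \<Sum>k\<in>I. K j k * q j * q k) -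
      c * s * (\<Sum>j\<in>I. \<Sum>k\<in>I. K j k * p j * p k) -
      s * s * (\<Sum>j\<in>I. \<Sum>k\<in>I. K j k * p j * q k)" (is ?mixed)
proof -
  have swap: "(\<Sum>j\<in>I. \<Sum>k\<in>I. K j k * q j * p k) = (\<Sum>j\<in>I. \<Sum>k\<in>I. K j k * p j * q k)"
    by (subst sum.swap) (simp add: sym mult_ac)
  have "(\<Sum>j\<in>I. \<Sum>k\<in>I. K j k * (c * p j + s * q j) * (c * p k + s * q k)) =
      c * c * (\<Sum>j\<in>I. \<Sum>k\<in>I. K j k * p j * p k) +
      c * s * (\<Sum>j\<in>I. \<Sum>k\<in>I. K j k * p j * q k) +
      c * s * (\<Sum>j\<in>I. \<Sum>k\<in>I. K j k * q j * p k) +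
      s * s * (\<Sum>j\<in>I. \<Sum>k\<in>I. K j k * q j * q k)"
    unfolding sum_distrib_left sum.distrib[symmetric]
    by (intro sum.cong refl) (simp add: algebra_simps)
  then show ?diagonal unfolding swap by simp
  have "(\<Sum>j\<in>I. \<Sum>k\<in>I. K j k * (c * p j + s * q j) * (c * q k - s * p k)) =
      c * c * (\<Sum>j\<in>I. \<Sum>k\<in>I. K j k * p j * q k) +
      c * s * (\<Sum>j\<in>I. \<Sum>k\<in>I. K j k * q j * q k) -
      c * s * (\<Sum>j\<in>I. \<Sum>k\<in>I. K j k * p j * p k) -
      s * s * (\<Sum>j\<in>I. \<Sum>k\<in>I. K j k * q j * p k)"
    unfolding sum_distrib_left sum.distrib[symmetric] sum_subtractf[symmetric]
    by (intro sum.cong refl) (simp add: algebra_simps)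
  then show ?mixed unfolding swap .
qed

text \<open>Stated for every \<open>V\<close>, whatever its height, because the identity is later
  differentiated along \<open>U + t \<cdot>\<^sub>v w\<close> with \<open>t\<close> ranging over all
  reals.\<close>

lemma flux_rot:
  assumes V: "V \<in> carrier_vec (2 * N + 3)"
  shows "rot N \<theta> *\<^sub>v (cos \<theta> \<cdot>\<^sub>v flux_F N g V + sin \<theta> \<cdot>\<^sub>v flux_G N g V) =
    flux_F N g (rot N \<theta> *\<^sub>v V)"
proof (rule eq_vecI)
  define c s h u v a b where defs: "c = cos \<theta>" "s = sin \<theta>" "h = height V" "u = um V" "v = vm V"
    "a = alpha V" "b = beta V"
  define W where "W = cos \<theta> \<cdot>\<^sub>v flux_F N g V + sin \<theta> \<cdot>\<^sub>v flux_G N g V"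
  let ?T = "rot N \<theta>" and ?V = "rot N \<theta> *\<^sub>v V" and ?F = "flux_F N g V" and ?G = "flux_G N g V"
  have W: "W \<in> carrier_vec (2 * N + 3)"
    by (rule carrier_vecI) (simp add: W_def flux_dim)
  have W_index: "W $ r = c * ?F $ r + s * ?G $ r" if "r < 2 * N + 3" for r
    using that by (simp add: W_def flux_dim defs(1,2))
  have cs: "s\<^sup>2 + c\<^sup>2 = 1" by (simp add: defs(1,2))
  note vars = state_variables_rot(1-3)[OF V, where \<theta> = \<theta>, folded defs]
  have ab: "alpha ?V j = c * a j + s * b j" "beta ?V j = c * b j - s * a j" if "j \<in> {1..N}" for j
    using state_variables_rot(4,5)[OF V, where i = j and \<theta> = \<theta>, folded defs] that by simp_all
  note rot_W = rot_mult_vec[OF W, where \<theta> = \<theta>, folded defs]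
  have W1: "W $ 1 = c * ?F $ 1 + s * ?G $ 1" and W2: "W $ 2 = c * ?F $ 2 + s * ?G $ 2"
    by (rule W_index; simp)+
  note rot_W_0 = rot_W(2,3)[where i = 0, unfolded mult_0_right add_0, OF le0]
  fix r assume "r < dim_vec (flux_F N g ?V)"
  then have "r < 2 * N + 3" by (simp add: flux_dim)
  then have "(rot N \<theta> *\<^sub>v W) $ r = flux_F N g ?V $ r"
  proof (cases rule: flux_index_cases)
    case 1
    have "W $ 0 = c * ?F $ 0 + s * ?G $ 0" by (rule W_index) simp
    then show ?thesis
      unfolding 1 rot_W(1) flux_F_index(1) flux_G_index(1) vars defs(3-)[symmetric]
      by (simp add: algebra_simps)
  next
    case 2
    have "(\<Sum>j=1..N. (alpha ?V j)\<^sup>2 / real (2 * j + 1)) =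
        c * c * (\<Sum>j=1..N. (a j)\<^sup>2 / real (2 * j + 1))
        + 2 * c * s * (\<Sum>j=1..N. a j * b j / real (2 * j + 1))
        + s * s * (\<Sum>j=1..N. (b j)\<^sup>2 / real (2 * j + 1))"
      unfolding sum_distrib_left sum.distrib[symmetric]
      by (intro sum.cong refl, simp only: ab) (simp add: add_divide_distrib power2_eq_square algebra_simps)
    \<comment> \<open>The gravity term gets the factor \<open>s\<^sup>2 + c\<^sup>2 = 1\<close>
      because it occurs in \<open>?F $ 1\<close> with weight \<open>c * c\<close> and in
      \<open>?G $ 2\<close> with weight \<open>s * s\<close>.\<close>
    then have "flux_F N g ?V $ 1 = h * ((c * u + s * v)\<^sup>2 +
        (c * c * (\<Sum>j=1..N. (a j)\<^sup>2 / real (2 * j + 1))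
        + 2 * c * s * (\<Sum>j=1..N. a j * b j / real (2 * j + 1))
        + s * s * (\<Sum>j=1..N. (b j)\<^sup>2 / real (2 * j + 1)))) + (s\<^sup>2 + c\<^sup>2) * (1 / 2 * g * h\<^sup>2)"
      unfolding cs flux_F_index vars by simp
    also have "\<dots> = c * (c * ?F $ 1 + s * ?G $ 1) + s * (c * ?F $ 2 + s * ?G $ 2)"
      unfolding flux_F_index flux_G_index defs(3-)[symmetric]
      by (simp add: power2_eq_square algebra_simps)
    also have "\<dots> = (rot N \<theta> *\<^sub>v W) $ 1"
      by (simp only: rot_W_0 W1 W2)
    finally show ?thesis by (simp only: 2)
  next
    case 3
    have form: "(\<Sum>j=1..N. alpha ?V j * beta ?V j / real (2 * j + 1)) =
        c * c * (\<Sum>j=1..N. a j * b j / real (2 * j + 1))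
        + c * s * (\<Sum>j=1..N. (b j)\<^sup>2 / real (2 * j + 1))
        - c * s * (\<Sum>j=1..N. (a j)\<^sup>2 / real (2 * j + 1))
        - s * s * (\<Sum>j=1..N. a j * b j / real (2 * j + 1))"
      unfolding sum_distrib_left sum.distrib[symmetric] sum_subtractf[symmetric]
      by (intro sum.cong refl, simp only: ab)
        (simp add: add_divide_distrib diff_divide_distrib power2_eq_square algebra_simps)
    \<comment> \<open>Here the gravity terms of \<open>?F $ 1\<close> and \<open>?G $ 2\<close> have
      the weights \<open>- s * c\<close> and \<open>c * s\<close> and cancel.\<close>
    have "flux_F N g ?V $ 2 = c * (c * ?F $ 2 + s * ?G $ 2) - s * (c * ?F $ 1 + s * ?G $ 1)"
      unfolding flux_F_index flux_G_index defs(3-)[symmetric] vars form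
      by (simp add: power2_eq_square algebra_simps)
    also have "\<dots> = (rot N \<theta> *\<^sub>v W) $ 2"
      by (simp only: rot_W_0 W1 W2)
    finally show ?thesis by (simp only: 3)
  next
    case (4 i)
    then have i: "i \<le> N" "2 * i + 1 < 2 * N + 3" "2 * i + 2 < 2 * N + 3" by auto
    have "(\<Sum>j=1..N. \<Sum>k=1..N. coeffA i j k * alpha ?V j * alpha ?V k) =
        (\<Sum>j=1..N. \<Sum>k=1..N. coeffA i j k * (c * a j + s * b j) * (c * a k + s * b k))"
      by (intro sum.cong refl) (simp only: ab)
    note form = trans[OF this symmetric_form_rotate(1)[of "coeffA i", OF coeffA_commute]]
    \<comment> \<open>\<open>?G $ (2 * i + 1)\<close> and \<open>?F $ (2 * i + 2)\<close> coincide
      and both enter with weight \<open>c * s\<close>; this matches the doubled mixed sum in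
      \<open>form\<close>.\<close>
    have "flux_F N g ?V $ (2 * i + 1) =
        c * (c * ?F $ (2 * i + 1) + s * ?G $ (2 * i + 1)) + s * (c * ?F $ (2 * i + 2) + s * ?G $ (2 * i + 2))"
      unfolding flux_F_index(4,5)[OF 4(1)] flux_G_index(4,5)[OF 4(1)] defs(3-)[symmetric] vars ab[OF 4(1)] form
      by (simp add: algebra_simps)
    also have "\<dots> = (rot N \<theta> *\<^sub>v W) $ (2 * i + 1)"
      by (simp only: rot_W(2,3)[OF i(1)] W_index[OF i(2)] W_index[OF i(3)])
    finally show ?thesis by (simp only: 4(2))
  next
    case (5 i)
    then have i: "i \<le> N" "2 * i + 1 < 2 * N + 3" "2 * i + 2 < 2 * N + 3" by auto
    have "(\<Sum>j=1..N. \<Sum>k=1..N. coeffA i j k * alpha ?V j * beta ?V k) =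
        (\<Sum>j=1..N. \<Sum>k=1..N. coeffA i j k * (c * a j + s * b j) * (c * b k - s * a k))"
      by (intro sum.cong refl) (simp only: ab)
    note form = trans[OF this symmetric_form_rotate(2)[of "coeffA i", OF coeffA_commute]]
    have "flux_F N g ?V $ (2 * i + 2) =
        c * (c * ?F $ (2 * i + 2) + s * ?G $ (2 * i + 2)) - s * (c * ?F $ (2 * i + 1) + s * ?G $ (2 * i + 1))"
      unfolding flux_F_index(4,5)[OF 5(1)] flux_G_index(4,5)[OF 5(1)] defs(3-)[symmetric] vars ab[OF 5(1)] form
      by (simp add: algebra_simps)
    also have "\<dots> = (rot N \<theta> *\<^sub>v W) $ (2 * i + 2)"
      by (simp only: rot_W(2,3)[OF i(1)] W_index[OF i(2)] W_index[OF i(3)])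
    finally show ?thesis by (simp only: 5(2))
  qed
  then show "(?T *\<^sub>v (cos \<theta> \<cdot>\<^sub>v ?F + sin \<theta> \<cdot>\<^sub>v ?G)) $ r = flux_F N g ?V $ r"
    by (simp only: W_def)
qed (use rot_carrier in \<open>simp add: flux_dim carrier_matD[OF rot_carrier]\<close>)

section \<open>Rotation of the Jacobians and of the non-conservative parts\<close>

lemma flux_jacobian_carrier:
  assumes "U \<in> carrier_vec (2 * N + 3)"
  shows "jacobian_mat (flux_F N g) U \<in> carrier_mat (2 * N + 3) (2 * N + 3)"
    and "jacobian_mat (flux_G N g) U \<in> carrier_mat (2 * N + 3) (2 * N + 3)"
  using jacobian_mat_carrier[of "flux_F N g" U] jacobian_mat_carrier[of "flux_G N g" U] assms
  by (simp_all add: flux_dim)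

text \<open>By \<open>flux_rot\<close> at \<open>U + t \<cdot>\<^sub>v w\<close>, both sides are
  derivatives at \<open>t = 0\<close> of the same curve, so they agree by uniqueness of the
  derivative.\<close>

lemma jacobian_rot:
  assumes U: "U \<in> carrier_vec (2 * N + 3)" and h: "height U \<noteq> 0" and w: "w \<in> carrier_vec (2 * N + 3)"
  shows "rot N \<theta> *\<^sub>v (cos \<theta> \<cdot>\<^sub>v (jacobian_mat (flux_F N g) U *\<^sub>v w) +
      sin \<theta> \<cdot>\<^sub>v (jacobian_mat (flux_G N g) U *\<^sub>v w)) =
    jacobian_mat (flux_F N g) (rot N \<theta> *\<^sub>v U) *\<^sub>v (rot N \<theta> *\<^sub>v w)" (is "?T *\<^sub>v ?X = ?J *\<^sub>v _")
proof (rule eq_vecI)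
  let ?n = "2 * N + 3"
  let ?F = "\<lambda>t. flux_F N g (U + t \<cdot>\<^sub>v w)" and ?G = "\<lambda>t. flux_G N g (U + t \<cdot>\<^sub>v w)"
  note J = flux_jacobian_carrier[OF U, of g]
  note J' = flux_jacobian_carrier[OF rot_mult_vec_carrier[of N \<theta> U], of g]
  fix r assume "r < dim_vec (?J *\<^sub>v (?T *\<^sub>v w))"
  then have r: "r < ?n" using J' by simp
  \<comment> \<open>As a finite sum, a row of the product can be differentiated term by term with
    scalar rules.\<close>
  have T_index: "(?T *\<^sub>v X) $ r = (\<Sum>k<?n. ?T $$ (r, k) * X $ k)" if "X \<in> carrier_vec ?n" for X
    using that r carrier_matD[OF rot_carrier[of N \<theta>]]
    by (auto simp: scalar_prod_def lessThan_atLeast0 intro!: sum.cong)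
  have X: "?X \<in> carrier_vec ?n" using J by (intro carrier_vecI) simp
  have "((\<lambda>t. \<Sum>k<?n. ?T $$ (r, k) * (cos \<theta> * ?F t $ k + sin \<theta> * ?G t $ k)) has_real_derivative
      (\<Sum>k<?n. ?T $$ (r, k) * (cos \<theta> * (jacobian_mat (flux_F N g) U *\<^sub>v w) $ k +
        sin \<theta> * (jacobian_mat (flux_G N g) U *\<^sub>v w) $ k))) (at 0)"
    by (intro DERIV_sum DERIV_cmult DERIV_add jacobian_mult_vec[OF U w] flux_differentiable[OF U h])
      (simp_all add: flux_dim)
  moreover have "(\<Sum>k<?n. ?T $$ (r, k) * (cos \<theta> * (jacobian_mat (flux_F N g) U *\<^sub>v w) $ k +
        sin \<theta> * (jacobian_mat (flux_G N g) U *\<^sub>v w) $ k)) = (?T *\<^sub>v ?X) $ r"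
    using J by (subst T_index[OF X]) (auto intro!: sum.cong)
  moreover have "(\<Sum>k<?n. ?T $$ (r, k) * (cos \<theta> * ?F t $ k + sin \<theta> * ?G t $ k)) =
      flux_F N g (?T *\<^sub>v U + t \<cdot>\<^sub>v (?T *\<^sub>v w)) $ r" for t
  proof -
    have Ut: "U + t \<cdot>\<^sub>v w \<in> carrier_vec ?n" using U w by simp
    have "?T *\<^sub>v (U + t \<cdot>\<^sub>v w) = ?T *\<^sub>v U + t \<cdot>\<^sub>v (?T *\<^sub>v w)"
      using mult_add_distrib_mat_vec[OF rot_carrier U smult_carrier_vec[of t, THEN iffD2, OF w]]
        mult_mat_vec[OF rot_carrier w] by simp
    moreover have "(?T *\<^sub>v (cos \<theta> \<cdot>\<^sub>v ?F t + sin \<theta> \<cdot>\<^sub>v ?G t)) $ r =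
        (\<Sum>k<?n. ?T $$ (r, k) * (cos \<theta> * ?F t $ k + sin \<theta> * ?G t $ k))"
      by (subst T_index) (auto simp: flux_dim intro!: carrier_vecI sum.cong)
    ultimately show ?thesis using flux_rot[OF Ut] by simp
  qed
  ultimately have "((\<lambda>t. flux_F N g (?T *\<^sub>v U + t \<cdot>\<^sub>v (?T *\<^sub>v w)) $ r)
      has_real_derivative (?T *\<^sub>v ?X) $ r) (at 0)"
    by simp
  \<comment> \<open>The rotated state has the same nonzero height, so the flux is differentiable
    there too.\<close>
  moreover have "((\<lambda>t. flux_F N g (?T *\<^sub>v U + t \<cdot>\<^sub>v (?T *\<^sub>v w)) $ r)
      has_real_derivative (?J *\<^sub>v (?T *\<^sub>v w)) $ r) (at 0)"
    using h r by (intro jacobian_mult_vec[OF rot_mult_vec_carrier rot_mult_vec_carrier]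
        flux_differentiable[OF rot_mult_vec_carrier])
      (simp_all add: flux_dim state_variables_rot(1)[OF U])
  ultimately show "(?T *\<^sub>v ?X) $ r = (?J *\<^sub>v (?T *\<^sub>v w)) $ r"
    by (rule DERIV_unique)
qed (simp add: carrier_matD[OF rot_carrier] carrier_matD[OF flux_jacobian_carrier(1)[OF rot_mult_vec_carrier]])

section \<open>Rotation of the non-conservative parts\<close>

lemma blocks_mult_vec:
  fixes N :: nat and M :: "nat \<Rightarrow> nat \<Rightarrow> real mat"
  defines "P \<equiv> four_block_mat (0\<^sub>m 3 3) (0\<^sub>m 3 (2 * N)) (0\<^sub>m (2 * N) 3) (blocks2 N M)"
  assumes w: "w \<in> carrier_vec (2 * N + 3)"
  shows "r < 3 \<Longrightarrow> (P *\<^sub>v w) $ r = 0"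
    and "i \<in> {1..N} \<Longrightarrow> (P *\<^sub>v w) $ (2 * i + 1) =
      (\<Sum>j=1..N. M i j $$ (0, 0) * w $ (2 * j + 1) + M i j $$ (0, 1) * w $ (2 * j + 2))"
    and "i \<in> {1..N} \<Longrightarrow> (P *\<^sub>v w) $ (2 * i + 2) =
      (\<Sum>j=1..N. M i j $$ (1, 0) * w $ (2 * j + 1) + M i j $$ (1, 1) * w $ (2 * j + 2))"
proof -
  have P: "P \<in> carrier_mat (2 * N + 3) (2 * N + 3)"
    by (rule carrier_matI) (simp_all add: P_def blocks2_def)
  have zero: "P $$ (r, c) = 0" if "r < 2 * N + 3" "c < 2 * N + 3" "r < 3 \<or> c < 3" for r c
    using that by (auto simp: P_def blocks2_def)
  \<comment> \<open>Three leading rows precede the blocks, and blocks are counted from 1: row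
    \<open>2 * i + 1 + a\<close> of \<open>P\<close> is row \<open>2 * (i - 1) + a\<close> of
    \<open>blocks2 N M\<close>. Columns behave alike.\<close>
  have block: "P $$ (2 * i + 1 + a, 2 * j + 1 + b) = M i j $$ (a, b)"
    if i: "i \<in> {1..N}" and j: "j \<in> {1..N}" and ab: "a < 2" "b < 2" for i j a b
  proof -
    obtain i' j' where ij: "i = Suc i'" "j = Suc j'"
      using i j by (metis atLeastAtMost_iff not0_implies_Suc not_one_le_zero)
    have "(2 * k + a) div 2 = k" "(2 * k + a) mod 2 = a" "(2 * k + b) div 2 = k" "(2 * k + b) mod 2 = b" for k
      using ab by auto
    then show ?thesis using i j ab by (simp add: P_def blocks2_def ij)
  qed
  have row: "(P *\<^sub>v w) $ r = (\<Sum>j=1..N. P $$ (r, 2 * j + 1) * w $ (2 * j + 1) +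
      P $$ (r, 2 * j + 2) * w $ (2 * j + 2))" if "r < 2 * N + 3" for r
  proof -
    \<comment> \<open>Column 0 and the columns 1 and 2 of pair 0 vanish, so only the pairs from 1 on
      remain.\<close>
    have "{..N} = insert 0 {1..N}" by auto
    then show ?thesis using that by (subst mult_vec_interleave[OF P w that]) (simp add: zero)
  qed
  show "r < 3 \<Longrightarrow> (P *\<^sub>v w) $ r = 0"
    by (subst row) (auto simp: zero intro!: sum.neutral)
  show "(P *\<^sub>v w) $ (2 * i + 1) =
      (\<Sum>j=1..N. M i j $$ (0, 0) * w $ (2 * j + 1) + M i j $$ (0, 1) * w $ (2 * j + 2))" if i: "i \<in> {1..N}"
    using i block[OF i, of _ 0 0] block[OF i, of _ 0 1] by (subst row) (auto intro!: sum.cong)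
  show "(P *\<^sub>v w) $ (2 * i + 2) =
      (\<Sum>j=1..N. M i j $$ (1, 0) * w $ (2 * j + 1) + M i j $$ (1, 1) * w $ (2 * j + 2))" if i: "i \<in> {1..N}"
    using i block[OF i, of _ 1 0] block[OF i, of _ 1 1] by (subst row) (auto intro!: sum.cong)
qed

lemma noncons_carrier:
  "noncons_P N U \<in> carrier_mat (2 * N + 3) (2 * N + 3)"
  "noncons_Q N U \<in> carrier_mat (2 * N + 3) (2 * N + 3)"
  by (auto simp: noncons_P_def noncons_Q_def blocks2_def intro!: carrier_matI)

lemma noncons_rot:
  assumes U: "U \<in> carrier_vec (2 * N + 3)" and w: "w \<in> carrier_vec (2 * N + 3)"
  shows "rot N \<theta> *\<^sub>v (cos \<theta> \<cdot>\<^sub>v (noncons_P N U *\<^sub>v w) + sin \<theta> \<cdot>\<^sub>v (noncons_Q N U *\<^sub>v w)) =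
    noncons_P N (rot N \<theta> *\<^sub>v U) *\<^sub>v (rot N \<theta> *\<^sub>v w)" (is "?T *\<^sub>v ?X = ?P *\<^sub>v _")
proof (rule eq_vecI)
  let ?n = "2 * N + 3"
  let ?U = "?T *\<^sub>v U"
  note PQ = noncons_carrier[of N U]
  have X: "?X \<in> carrier_vec ?n" using PQ by (intro carrier_vecI) simp
  have X_index: "?X $ r = cos \<theta> * (noncons_P N U *\<^sub>v w) $ r + sin \<theta> * (noncons_Q N U *\<^sub>v w) $ r"
    if "r < ?n" for r
    using that PQ by auto
  \<comment> \<open>\<open>p\<close> and \<open>q\<close> are the entries of the one column that a
    block of \<open>P\<close> shares with the corresponding block of \<open>Q\<close>.\<close>
  define p where "p U i j = - (if i = j then um U else 0) + (\<Sum>k=1..N. coeffB i j k * alpha U k)" for U i j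
  define q where "q U i j = - (if i = j then vm U else 0) + (\<Sum>k=1..N. coeffB i j k * beta U k)" for U i j
  have block: "block_P N U i j $$ (0, 0) = p U i j" "block_P N U i j $$ (0, Suc 0) = 0"
    "block_P N U i j $$ (Suc 0, 0) = q U i j" "block_P N U i j $$ (Suc 0, Suc 0) = 0"
    "block_Q N U i j $$ (0, 0) = 0" "block_Q N U i j $$ (0, Suc 0) = p U i j"
    "block_Q N U i j $$ (Suc 0, 0) = 0" "block_Q N U i j $$ (Suc 0, Suc 0) = q U i j" for U i j
    by (simp_all add: block_P_def block_Q_def mat_of_rows_list_def p_def q_def)
  \<comment> \<open>\<open>P\<close> multiplies this column by the \<alpha>-entries of
    \<open>w\<close>, and \<open>Q\<close> multiplies it by the \<beta>-entries.\<close>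
  have P_row: "(noncons_P N U *\<^sub>v w) $ (2 * i + 1) = (\<Sum>j=1..N. p U i j * w $ (2 * j + 1))"
      "(noncons_P N U *\<^sub>v w) $ (2 * i + 2) = (\<Sum>j=1..N. q U i j * w $ (2 * j + 1))"
      "(noncons_Q N U *\<^sub>v w) $ (2 * i + 1) = (\<Sum>j=1..N. p U i j * w $ (2 * j + 2))"
      "(noncons_Q N U *\<^sub>v w) $ (2 * i + 2) = (\<Sum>j=1..N. q U i j * w $ (2 * j + 2))"
    if "i \<in> {1..N}" "w \<in> carrier_vec ?n" for U w i
    unfolding noncons_P_def noncons_Q_def blocks_mult_vec(2,3)[OF that(2,1)] by (simp_all add: block)
  have zero: "(noncons_P N U *\<^sub>v w) $ r = 0" "(noncons_Q N U *\<^sub>v w) $ r = 0"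
    if "r < 3" "w \<in> carrier_vec ?n" for U w r
    unfolding noncons_P_def noncons_Q_def using blocks_mult_vec(1)[OF that(2,1)] by auto
  have sums: "(\<Sum>k=1..N. coeffB i j k * alpha ?U k) =
        cos \<theta> * (\<Sum>k=1..N. coeffB i j k * alpha U k) + sin \<theta> * (\<Sum>k=1..N. coeffB i j k * beta U k)"
      "(\<Sum>k=1..N. coeffB i j k * beta ?U k) =
        cos \<theta> * (\<Sum>k=1..N. coeffB i j k * beta U k) - sin \<theta> * (\<Sum>k=1..N. coeffB i j k * alpha U k)" for i j
    unfolding sum_distrib_left sum.distrib[symmetric] sum_subtractf[symmetric]
    by (auto simp: state_variables_rot(4,5)[OF U] algebra_simps intro!: sum.cong)
  have p_rot: "p ?U i j = cos \<theta> * p U i j + sin \<theta> * q U i j" for i j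
    unfolding p_def q_def sums by (simp add: state_variables_rot(2)[OF U] algebra_simps)
  have q_rot: "q ?U i j = cos \<theta> * q U i j - sin \<theta> * p U i j" for i j
    unfolding p_def q_def sums by (simp add: state_variables_rot(3)[OF U] algebra_simps)
  \<comment> \<open>The second column of each block of \<open>P\<close> is zero, so only the first
    entry of a rotated pair of \<open>w\<close> matters.\<close>
  have w_rot: "(?T *\<^sub>v w) $ (2 * j + 1) = cos \<theta> * w $ (2 * j + 1) + sin \<theta> * w $ (2 * j + 2)"
    if "j \<in> {1..N}" for j
    using rot_mult_vec(2)[OF w] that by simp
  \<comment> \<open>Pair 0 of \<open>?X\<close> is zero, hence so is its rotation; this settles rows
    1 and 2.\<close>
  have X_0: "?X $ 1 = 0" "?X $ 2 = 0"
    by (subst X_index; simp add: zero w del: index_mult_mat_vec)+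
  note rot_X_0 = rot_mult_vec(2,3)[OF X, where i = 0 and \<theta> = \<theta>, unfolded mult_0_right add_0, OF le0]
  fix r assume "r < dim_vec (?P *\<^sub>v (?T *\<^sub>v w))"
  then have "r < ?n" using noncons_carrier(1)[of N ?U] by simp
  then show "(?T *\<^sub>v ?X) $ r = (?P *\<^sub>v (?T *\<^sub>v w)) $ r"
  proof (cases rule: flux_index_cases)
    case 1
    have "?X $ 0 = 0"
      by (subst X_index) (simp_all add: zero w del: index_mult_mat_vec)
    then show ?thesis
      by (simp only: 1 rot_mult_vec(1)[OF X] zero rot_mult_vec_carrier zero_less_numeral)
  next
    case 2
    show ?thesis
      by (simp add: 2 rot_X_0 X_0 zero rot_mult_vec_carrier del: index_mult_mat_vec One_nat_def)
  next
    case 3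
    show ?thesis
      by (simp add: 3 rot_X_0 X_0 zero rot_mult_vec_carrier del: index_mult_mat_vec One_nat_def)
  next
    case (4 i)
    then have i: "i \<le> N" "2 * i + 1 < ?n" "2 * i + 2 < ?n" by auto
    \<comment> \<open>For each \<open>j\<close> the left side factors into
      \<open>cos \<theta> * p U i j + sin \<theta> * q U i j\<close> and the first entry of the
      rotated pair \<open>j\<close> of \<open>w\<close>.\<close>
    show ?thesis
      unfolding 4(2) rot_mult_vec(2)[OF X i(1)] X_index[OF i(2)] X_index[OF i(3)] P_row[OF 4(1) w]
        P_row[OF 4(1) rot_mult_vec_carrier]
        sum_distrib_left sum.distrib[symmetric] distrib_left
      by (intro sum.cong refl, simp only: w_rot p_rot) (simp add: algebra_simps)
  next
    case (5 i)
    then have i: "i \<le> N" "2 * i + 1 < ?n" "2 * i + 2 < ?n" by auto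
    show ?thesis
      unfolding 5(2) rot_mult_vec(3)[OF X i(1)] X_index[OF i(2)] X_index[OF i(3)] P_row[OF 5(1) w]
        P_row[OF 5(1) rot_mult_vec_carrier]
        sum_distrib_left sum.distrib[symmetric] distrib_left sum_subtractf[symmetric]
      by (intro sum.cong refl, simp only: w_rot q_rot) (simp add: algebra_simps)
  qed
qed (simp add: carrier_matD[OF rot_carrier] carrier_matD[OF noncons_carrier(1)])

section \<open>Rotation of the coefficient matrices\<close>

lemma swme_carrier:
  assumes "U \<in> carrier_vec (2 * N + 3)"
  shows "swme_A N g U \<in> carrier_mat (2 * N + 3) (2 * N + 3)"
    and "swme_B N g U \<in> carrier_mat (2 * N + 3) (2 * N + 3)"
  unfolding swme_A_def swme_B_def by (simp_all add: noncons_carrier)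

text \<open>Applied to a vector \<open>w\<close>, this is the sum of \<open>jacobian_rot\<close> and
  \<open>noncons_rot\<close>. The rotation stays on the left side, so that no inverse appears before
  the final theorem.\<close>

lemma swme_rot:
  assumes U: "U \<in> carrier_vec (2 * N + 3)" and h: "height U \<noteq> 0"
  shows "rot N \<theta> * (cos \<theta> \<cdot>\<^sub>m swme_A N g U + sin \<theta> \<cdot>\<^sub>m swme_B N g U) =
    swme_A N g (rot N \<theta> *\<^sub>v U) * rot N \<theta>"
proof (rule mat_eq_if_mult_vec_eq)
  let ?n = "2 * N + 3"
  let ?T = "rot N \<theta>" and ?A = "swme_A N g U" and ?B = "swme_B N g U" and ?A' = "swme_A N g (rot N \<theta> *\<^sub>v U)"
  let ?JF = "jacobian_mat (flux_F N g)" and ?JG = "jacobian_mat (flux_G N g)"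
  let ?P = "noncons_P N" and ?Q = "noncons_Q N"
  note AB = swme_carrier[OF U, of g] and A' = swme_carrier(1)[OF rot_mult_vec_carrier[of N \<theta> U], of g]
  note J = flux_jacobian_carrier[OF U, of g] and PQ = noncons_carrier[of N U]
  have sum_carrier: "cos \<theta> \<cdot>\<^sub>m ?A + sin \<theta> \<cdot>\<^sub>m ?B \<in> carrier_mat ?n ?n"
    using AB by simp
  show "?T * (cos \<theta> \<cdot>\<^sub>m ?A + sin \<theta> \<cdot>\<^sub>m ?B) \<in> carrier_mat ?n ?n"
    by (rule mult_carrier_mat[OF rot_carrier sum_carrier])
  show "?A' * ?T \<in> carrier_mat ?n ?n"
    by (rule mult_carrier_mat[OF A' rot_carrier])
  fix w :: "real vec" assume w: "w \<in> carrier_vec ?n"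
  note Tw = rot_mult_vec_carrier[of N \<theta> w]
  let ?X = "cos \<theta> \<cdot>\<^sub>v (?JF U *\<^sub>v w) + sin \<theta> \<cdot>\<^sub>v (?JG U *\<^sub>v w)"
  let ?Y = "cos \<theta> \<cdot>\<^sub>v (?P U *\<^sub>v w) + sin \<theta> \<cdot>\<^sub>v (?Q U *\<^sub>v w)"
  have XY: "?X \<in> carrier_vec ?n" "?Y \<in> carrier_vec ?n"
    using J PQ by (auto intro!: carrier_vecI)
  have smult: "(k \<cdot>\<^sub>m M) *\<^sub>v w = k \<cdot>\<^sub>v (M *\<^sub>v w)" if "M \<in> carrier_mat ?n ?n" for k and M :: "real mat"
    using that w by (intro eq_vecI) auto
  have "(cos \<theta> \<cdot>\<^sub>m ?A + sin \<theta> \<cdot>\<^sub>m ?B) *\<^sub>v w = cos \<theta> \<cdot>\<^sub>v (?A *\<^sub>v w) + sin \<theta> \<cdot>\<^sub>v (?B *\<^sub>v w)"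
    using AB w by (simp add: add_mult_distrib_mat_vec[of _ ?n ?n] smult)
  also have "\<dots> = cos \<theta> \<cdot>\<^sub>v (?JF U *\<^sub>v w + ?P U *\<^sub>v w) + sin \<theta> \<cdot>\<^sub>v (?JG U *\<^sub>v w + ?Q U *\<^sub>v w)"
    unfolding swme_A_def swme_B_def add_mult_distrib_mat_vec[OF J(1) PQ(1) w]
      add_mult_distrib_mat_vec[OF J(2) PQ(2) w] ..
  also have "\<dots> = ?X + ?Y"
    using carrier_matD[OF J(1)] carrier_matD[OF J(2)] carrier_matD[OF PQ(1)] carrier_matD[OF PQ(2)]
    by (intro eq_vecI) (simp_all add: algebra_simps del: index_mult_mat_vec)
  finally have "?T *\<^sub>v ((cos \<theta> \<cdot>\<^sub>m ?A + sin \<theta> \<cdot>\<^sub>m ?B) *\<^sub>v w) = ?T *\<^sub>v ?X + ?T *\<^sub>v ?Y"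
    using mult_add_distrib_mat_vec[OF rot_carrier XY] by simp
  also have "\<dots> = ?A' *\<^sub>v (?T *\<^sub>v w)"
    unfolding jacobian_rot[OF U h w] noncons_rot[OF U w] swme_A_def
    by (rule add_mult_distrib_mat_vec[OF flux_jacobian_carrier(1)[OF rot_mult_vec_carrier]
          noncons_carrier(1) Tw, symmetric])
  finally show "?T * (cos \<theta> \<cdot>\<^sub>m ?A + sin \<theta> \<cdot>\<^sub>m ?B) *\<^sub>v w = ?A' * ?T *\<^sub>v w"
    using assoc_mult_mat_vec[OF rot_carrier sum_carrier w] assoc_mult_mat_vec[OF A' rot_carrier w]
    by simp
qed

theorem theorem3p1:
  fixes N :: nat and g \<theta> :: real and U :: "real vec"
  assumes "N \<ge> 1" and "g > 0"
    and "0 \<le> \<theta>" and "\<theta> < 2 * pi"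
    and "U \<in> carrier_vec (2 * N + 3)" and "height U > 0"
  shows "\<exists>Tinv. mat_inverse (rot N \<theta>) = Some Tinv \<and>
    cos \<theta> \<cdot>\<^sub>m swme_A N g U + sin \<theta> \<cdot>\<^sub>m swme_B N g U =
      Tinv * swme_A N g (rot N \<theta> *\<^sub>v U) * rot N \<theta>"
proof -
  let ?n = "2 * N + 3" and ?C = "cos \<theta> \<cdot>\<^sub>m swme_A N g U + sin \<theta> \<cdot>\<^sub>m swme_B N g U"
  note T = rot_carrier[of N \<theta>]
  \<comment> \<open>\<open>mat_inverse\<close> yields \<open>None\<close> only for non-units, and
    \<open>rot N (- \<theta>)\<close> is a two-sided inverse: \<open>rot_inverse\<close> at \<theta>
    and at -\<theta> gives the two products.\<close>
  have "mat_inverse (rot N \<theta>) \<noteq> None"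
  proof
    assume "mat_inverse (rot N \<theta>) = None"
    then have "rot N \<theta> \<notin> Units (ring_mat TYPE(real) ?n ())"
      by (rule mat_inverse(1)[OF T])
    moreover have "rot N \<theta> * rot N (- \<theta>) = 1\<^sub>m ?n"
      using rot_inverse[of N "- \<theta>"] by simp
    ultimately show False
      using T rot_carrier[of N "- \<theta>"] rot_inverse[of N \<theta>]
      by (auto simp: Units_def ring_mat_simps)
  qed
  then obtain Tinv where Tinv: "mat_inverse (rot N \<theta>) = Some Tinv" by blast
  note inv = mat_inverse(2)[OF T Tinv]
  have C: "?C \<in> carrier_mat ?n ?n"
    using swme_carrier[OF assms(5), of g] by simp
  have "Tinv * swme_A N g (rot N \<theta> *\<^sub>v U) * rot N \<theta> =
      Tinv * (swme_A N g (rot N \<theta> *\<^sub>v U) * rot N \<theta>)"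
    using inv by (intro assoc_mult_mat[OF _ swme_carrier(1)[OF rot_mult_vec_carrier] T]) auto
  also have "\<dots> = Tinv * (rot N \<theta> * ?C)"
    using swme_rot[OF assms(5)] assms(6) by simp
  also have "\<dots> = Tinv * rot N \<theta> * ?C"
    using inv by (intro assoc_mult_mat[OF _ T C, symmetric]) auto
  also have "\<dots> = ?C"
    using inv left_mult_one_mat[OF C] by simp
  finally show ?thesis using Tinv by auto
qed

end
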